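(* Let $p$ be a real number and let $E$ be a Banach lattice. If $E$ has cotype $p$ and $E^\ast$ has the disjoint Dunford-Pettis property of order $p$ (disjoint $DPP_p$), then $E$ has the disjoint $DPP_p$.
   Context: A Banach space $X$ has cotype $p$, where necessarily $p \geq 2$, if there is a constant $C > 0$ such that for every finite subset $\{x_1, \dots, x_n\} \subset X$, $$\left( \sum_{k=1}^n \|x_k\|^p \right)^{1/p} \leq C \cdot \left( \int_0^1 \left\| \sum_{k=1}^n r_k(t) x_k \right\|^2 dt \right)^{1/2},$$ where $(r_k)_k$ denotes the Rademacher sequence. $E^\ast$ denotes the dual Banach lattice of $E$. A sequence $(x_n)_n$ in a Banach lattice is disjoint if $|x_n| \wedge |x_m| = 0$ whenever $n \neq m$. A sequence $(x_n)_n$ in a Banach space $X$ is weakly $p$-summable if $\sum_n |x^\ast(x_n)|^p < \infty$ for every $x^\ast \in X^\ast$. A subset $A$ of a Banach space $X$ is a Dunford-Pettis set if every weakly null sequence in $X^\ast$ converges uniformly to zero on $A$. A Banach lattice has the disjoint Dunford-Pettis property of order $p$ (disjoint $DPP_p$) if, for every disjoint weakly $p$-summable sequence $(x_n)_n$ in it, the set $\{x_n : n \in \mathbb{N}\}$ is a Dunford-Pettis set. *)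

theory Defs
  imports "HOL-Analysis.Analysis" "HOL-Library.Lattice_Algebras"
begin

section \<open>Banach lattices\<close>

class banach_lattice = banach + ordered_real_vector + lattice_ab_group_add_abs +
  assumes norm_mono_abs: "\<bar>x\<bar> \<le> \<bar>y\<bar> \<Longrightarrow> norm x \<le> norm y"

instance real :: banach_lattice
  by standard simp

text \<open>
  The dual of \<open>E\<close> is the type \<open>E \<Rightarrow>\<^sub>L real\<close>.  A class instance cannot single out the codomain
  \<open>real\<close>, so the Banach lattice structure is set up for any order complete codomain whose closed
  unit ball is an order interval \<open>[-e, e]\<close>; for such a codomain every bounded operator is regular,
  and the regular norm is the operator norm.
\<close>

class order_complete_unit_banach_lattice = banach_lattice + conditionally_complete_lattice +
  assumes ex_order_unit: "\<exists>e. \<forall>x. norm x \<le> 1 \<longleftrightarrow> \<bar>x\<bar> \<le> e"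

instance real :: order_complete_unit_banach_lattice
  by standard (auto intro: exI[of _ 1])

lemma norm_abs_eq: "norm \<bar>x :: 'a::banach_lattice\<bar> = norm x"
  by (intro order.antisym norm_mono_abs) simp_all

lemma norm_mono_nonneg: "0 \<le> x \<Longrightarrow> x \<le> y \<Longrightarrow> norm x \<le> norm y"
  for x y :: "'a::banach_lattice"
  by (rule norm_mono_abs) (metis abs_of_nonneg order.trans)

definition order_unit :: "'a::order_complete_unit_banach_lattice" where
  "order_unit = (SOME e. \<forall>x. norm x \<le> 1 \<longleftrightarrow> \<bar>x\<bar> \<le> e)"

lemma norm_le_one_iff_abs_le_order_unit:
  "norm x \<le> 1 \<longleftrightarrow> \<bar>x\<bar> \<le> (order_unit :: 'a::order_complete_unit_banach_lattice)"
  using someI_ex[OF ex_order_unit] unfolding order_unit_def by blast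

lemma order_unit_nonneg: "0 \<le> (order_unit :: 'a::order_complete_unit_banach_lattice)"
  using norm_le_one_iff_abs_le_order_unit[of "0::'a"] by simp

lemma abs_scaleR_pos:
  assumes "0 < (c::real)"
  shows "\<bar>c *\<^sub>R x\<bar> = c *\<^sub>R \<bar>x :: 'a::banach_lattice\<bar>"
proof -
  have le: "\<bar>c *\<^sub>R x\<bar> \<le> c *\<^sub>R \<bar>x\<bar>" if "0 < c" for c and x :: 'a
  proof (rule abs_leI)
    show "c *\<^sub>R x \<le> c *\<^sub>R \<bar>x\<bar>"
      by (rule scaleR_left_mono) (use that in \<open>auto intro: abs_ge_self\<close>)
    have "c *\<^sub>R (- x) \<le> c *\<^sub>R \<bar>x\<bar>"
      by (rule scaleR_left_mono) (use that abs_ge_minus_self in auto)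
    then show "- (c *\<^sub>R x) \<le> c *\<^sub>R \<bar>x\<bar>"
      by simp
  qed
  have "c *\<^sub>R \<bar>inverse c *\<^sub>R (c *\<^sub>R x)\<bar> \<le> c *\<^sub>R (inverse c *\<^sub>R \<bar>c *\<^sub>R x\<bar>)"
    by (rule scaleR_left_mono[OF le]) (use assms in auto)
  then have "c *\<^sub>R \<bar>x\<bar> \<le> \<bar>c *\<^sub>R x\<bar>"
    using assms by simp
  with le[OF assms, of x] show ?thesis
    by (rule order.antisym)
qed

lemma norm_le_iff_abs_le_order_unit:
  fixes x :: "'a::order_complete_unit_banach_lattice"
  assumes "0 \<le> c"
  shows "norm x \<le> c \<longleftrightarrow> \<bar>x\<bar> \<le> c *\<^sub>R order_unit"
proof (cases "c = 0")
  case True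
  then show ?thesis by simp
next
  case False
  with assms have c: "0 < c" by simp
  have "norm x \<le> c \<longleftrightarrow> inverse c * norm x \<le> 1"
    using c by (simp add: field_simps)
  also have "inverse c * norm x = norm (inverse c *\<^sub>R x)"
    using c by simp
  also have "norm (inverse c *\<^sub>R x) \<le> 1 \<longleftrightarrow> inverse c *\<^sub>R \<bar>x\<bar> \<le> order_unit"
    using c by (simp only: norm_le_one_iff_abs_le_order_unit abs_scaleR_pos positive_imp_inverse_positive)
  also have "\<dots> \<longleftrightarrow> \<bar>x\<bar> \<le> c *\<^sub>R order_unit"
    using c by (simp add: pos_le_divideR_eq pos_divideR_le_eq)
  finally show ?thesis .
qed


section \<open>The dual Banach lattice\<close>

text \<open>The order is pointwise on the positive cone; the positive part of \<open>T\<close> is given by the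
  Riesz--Kantorovich formula \<open>T\<^sup>+ x = Sup {T y | 0 \<le> y \<le> x}\<close> for \<open>x \<ge> 0\<close>.\<close>

definition rk_cone ::
  "('a::banach_lattice \<Rightarrow>\<^sub>L 'b::order_complete_unit_banach_lattice) \<Rightarrow> 'a \<Rightarrow> 'b" where
  "rk_cone T x = Sup (blinfun_apply T ` {0..x})"

definition blinfun_pos_part ::
  "('a::banach_lattice \<Rightarrow>\<^sub>L 'b::order_complete_unit_banach_lattice) \<Rightarrow> 'a \<Rightarrow>\<^sub>L 'b" where
  "blinfun_pos_part T = Blinfun (\<lambda>x. rk_cone T (sup x 0) - rk_cone T (sup (- x) 0))"

context
  fixes T :: "'a::banach_lattice \<Rightarrow>\<^sub>L 'b::order_complete_unit_banach_lattice"
begin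

lemma blinfun_abs_le_order_unit:
  assumes "norm y \<le> c"
  shows "\<bar>T y\<bar> \<le> (norm T * c) *\<^sub>R order_unit"
proof -
  have "norm (T y) \<le> norm T * c"
    by (rule order.trans[OF norm_blinfun]) (use assms in \<open>simp add: mult_left_mono\<close>)
  moreover have "0 \<le> c"
    using assms norm_ge_zero order.trans by blast
  ultimately show ?thesis
    using norm_le_iff_abs_le_order_unit[of "norm T * c" "T y"] by simp
qed

lemma rk_bound: "T y \<le> (norm T * norm x) *\<^sub>R order_unit" if "0 \<le> y" "y \<le> x" for x y :: 'a
  by (rule order.trans[OF abs_ge_self blinfun_abs_le_order_unit])
     (rule norm_mono_nonneg[OF that])

lemma rk_upper: "0 \<le> y \<Longrightarrow> y \<le> x \<Longrightarrow> T y \<le> rk_cone T x"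
  unfolding rk_cone_def by (rule cSup_upper) (auto intro!: bdd_aboveI2 rk_bound)

lemma rk_least: "0 \<le> x \<Longrightarrow> (\<And>y. 0 \<le> y \<Longrightarrow> y \<le> x \<Longrightarrow> T y \<le> z) \<Longrightarrow> rk_cone T x \<le> z"
  unfolding rk_cone_def by (rule cSup_least) auto

lemma rk_nonneg: "0 \<le> x \<Longrightarrow> 0 \<le> rk_cone T x"
  using rk_upper[of 0 x] by (simp add: blinfun.zero_right)

lemma rk_add:
  assumes "0 \<le> x" "0 \<le> x'"
  shows "rk_cone T (x + x') = rk_cone T x + rk_cone T x'"
proof (rule order.antisym)
  show "rk_cone T (x + x') \<le> rk_cone T x + rk_cone T x'"
  proof (rule rk_least)
    fix z assume z: "0 \<le> z" "z \<le> x + x'"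
    have d: "z - inf z x = sup 0 (z - x)"
      using add_sup_distrib_left[of z "- z" "- x"] by (simp add: diff_inf_eq_sup)
    have "T (inf z x) \<le> rk_cone T x"
      by (rule rk_upper) (use z assms in auto)
    moreover have "T (z - inf z x) \<le> rk_cone T x'"
      by (rule rk_upper) (use z assms in \<open>simp_all only: d, auto simp: diff_le_eq add.commute\<close>)
    ultimately have "T (inf z x) + T (z - inf z x) \<le> rk_cone T x + rk_cone T x'"
      by (rule add_mono)
    moreover have "T (inf z x) + T (z - inf z x) = T z"
      unfolding blinfun.add_right[symmetric] by (metis add.commute diff_add_cancel)
    ultimately show "T z \<le> rk_cone T x + rk_cone T x'"
      by simp
  qed (use assms in simp)
  have "rk_cone T x \<le> rk_cone T (x + x') - rk_cone T x'"
  proof (rule rk_least)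
    fix y assume y: "0 \<le> y" "y \<le> x"
    have "rk_cone T x' \<le> rk_cone T (x + x') - T y"
    proof (rule rk_least)
      fix y' assume y': "0 \<le> y'" "y' \<le> x'"
      have "T (y + y') \<le> rk_cone T (x + x')"
        by (rule rk_upper) (use y y' in \<open>auto intro: add_mono\<close>)
      then show "T y' \<le> rk_cone T (x + x') - T y"
        by (simp add: blinfun.add_right algebra_simps)
    qed (use assms in simp)
    then show "T y \<le> rk_cone T (x + x') - rk_cone T x'"
      by (simp add: algebra_simps)
  qed (use assms in simp)
  then show "rk_cone T x + rk_cone T x' \<le> rk_cone T (x + x')"
    by (simp add: algebra_simps)
qed

lemma rk_scaleR:
  assumes "0 \<le> c" "0 \<le> x"
  shows "rk_cone T (c *\<^sub>R x) = c *\<^sub>R rk_cone T x"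
proof (cases "c = 0")
  case True
  have "rk_cone T 0 = 0"
    using rk_add[of 0 0] by simp
  with True show ?thesis by simp
next
  case False
  with assms have c: "0 < c" by simp
  have le: "c *\<^sub>R rk_cone T x \<le> rk_cone T (c *\<^sub>R x)" if c: "0 < c" and x: "0 \<le> x" for c x
  proof -
    have "rk_cone T x \<le> inverse c *\<^sub>R rk_cone T (c *\<^sub>R x)"
    proof (rule rk_least[OF x])
      fix y assume y: "0 \<le> y" "y \<le> x"
      have "T (c *\<^sub>R y) \<le> rk_cone T (c *\<^sub>R x)"
        by (rule rk_upper) (use y c in \<open>auto intro: scaleR_left_mono scaleR_nonneg_nonneg\<close>)
      then have "inverse c *\<^sub>R T (c *\<^sub>R y) \<le> inverse c *\<^sub>R rk_cone T (c *\<^sub>R x)"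
        by (rule scaleR_left_mono) (use c in auto)
      then show "T y \<le> inverse c *\<^sub>R rk_cone T (c *\<^sub>R x)"
        using c by (simp add: blinfun.scaleR_right)
    qed
    then have "c *\<^sub>R rk_cone T x \<le> c *\<^sub>R (inverse c *\<^sub>R rk_cone T (c *\<^sub>R x))"
      by (rule scaleR_left_mono) (use c in auto)
    then show ?thesis
      using c by simp
  qed
  have "c *\<^sub>R (inverse c *\<^sub>R rk_cone T (c *\<^sub>R x)) \<le> c *\<^sub>R rk_cone T (inverse c *\<^sub>R (c *\<^sub>R x))"
    by (intro scaleR_left_mono le) (use c assms in \<open>auto intro: scaleR_nonneg_nonneg\<close>)
  then have "rk_cone T (c *\<^sub>R x) \<le> c *\<^sub>R rk_cone T x"
    using c by simp
  with le[OF c assms(2)] show ?thesis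
    by (simp add: order.antisym)
qed

lemma nprt_eq: "nprt x = - sup (- x) (0 :: 'a)"
  unfolding nprt_def inf_eq_neg_sup[of x 0] by (simp only: minus_zero)

lemma sup_diff_parts: "sup x 0 - sup (- x) 0 = (x :: 'a)"
  using prts[of x] unfolding nprt_eq pprt_def by (simp only: diff_conv_add_uminus)

lemma sup_sum_parts: "sup x 0 + sup (- x) 0 = \<bar>x :: 'a\<bar>"
  using abs_prts[of x] unfolding nprt_eq pprt_def by (simp only: diff_minus_eq_add)

lemma rk_diff:
  assumes "0 \<le> a" "0 \<le> b"
  shows "rk_cone T (sup (a - b) 0) - rk_cone T (sup (- (a - b)) 0) = rk_cone T a - rk_cone T b"
proof -
  have cancel: "u + d = c + v" if "u - v = c - d" for u v c d :: "'c::ab_group_add"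
    using that by (simp add: diff_eq_eq)
  have "sup (a - b) 0 + b = a + sup (- (a - b)) 0"
    by (rule cancel) (rule sup_diff_parts)
  then have "rk_cone T (sup (a - b) 0) + rk_cone T b = rk_cone T a + rk_cone T (sup (- (a - b)) 0)"
    using assms by (metis rk_add sup_ge2)
  then show ?thesis
    by (simp add: algebra_simps)
qed

lemma blinfun_pos_part_bounded_linear:
  "bounded_linear (\<lambda>x. rk_cone T (sup x 0) - rk_cone T (sup (- x) 0))" (is "bounded_linear ?Q")
proof (rule bounded_linear_intro)
  have Q: "?Q x = rk_cone T a - rk_cone T b" if "0 \<le> a" "0 \<le> b" "x = a - b" for x a b
    using rk_diff[OF that(1,2)] that(3) by simp
  fix x y :: 'a
  have "?Q (x + y) = rk_cone T (sup x 0 + sup y 0) - rk_cone T (sup (- x) 0 + sup (- y) 0)"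
  proof (rule Q)
    have "x + y = (sup x 0 - sup (- x) 0) + (sup y 0 - sup (- y) 0)"
      by (simp only: sup_diff_parts)
    then show "x + y = sup x 0 + sup y 0 - (sup (- x) 0 + sup (- y) 0)"
      by (simp only: add_diff_add)
  qed (auto intro: add_nonneg_nonneg)
  then show "?Q (x + y) = ?Q x + ?Q y"
    by (simp add: rk_add)
  fix r :: real
  show "?Q (r *\<^sub>R x) = r *\<^sub>R ?Q x"
  proof (cases "0 \<le> r")
    case True
    have "?Q (r *\<^sub>R x) = rk_cone T (r *\<^sub>R sup x 0) - rk_cone T (r *\<^sub>R sup (- x) 0)"
    proof (rule Q)
      show "r *\<^sub>R x = r *\<^sub>R sup x 0 - r *\<^sub>R sup (- x) 0"
        by (simp only: scaleR_diff_right[symmetric] sup_diff_parts)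
    qed (use True in \<open>auto intro: scaleR_nonneg_nonneg\<close>)
    then show ?thesis
      using True by (simp add: rk_scaleR scaleR_diff_right)
  next
    case False
    have "?Q (r *\<^sub>R x) = rk_cone T ((- r) *\<^sub>R sup (- x) 0) - rk_cone T ((- r) *\<^sub>R sup x 0)"
    proof (rule Q)
      have "r *\<^sub>R u - r *\<^sub>R v = (- r) *\<^sub>R v - (- r) *\<^sub>R u" for u v :: 'a
        by simp
      then have "r *\<^sub>R (sup x 0 - sup (- x) 0) = (- r) *\<^sub>R sup (- x) 0 - (- r) *\<^sub>R sup x 0"
        unfolding scaleR_diff_right .
      then show "r *\<^sub>R x = (- r) *\<^sub>R sup (- x) 0 - (- r) *\<^sub>R sup x 0"
        unfolding sup_diff_parts .
    qed (use False in \<open>auto intro!: scaleR_nonneg_nonneg simp del: scaleR_minus_left\<close>)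
    also have "\<dots> = (- r) *\<^sub>R rk_cone T (sup (- x) 0) - (- r) *\<^sub>R rk_cone T (sup x 0)"
      using False by (subst (1 2) rk_scaleR) auto
    finally show ?thesis
      by (simp add: algebra_simps)
  qed
  have "\<bar>?Q x\<bar> \<le> rk_cone T (sup x 0) + rk_cone T (sup (- x) 0)"
    using rk_nonneg[of "sup x 0"] rk_nonneg[of "sup (- x) 0"]
    by (intro abs_leI)
       (simp_all add: diff_le_eq add_increasing add_increasing2 add.assoc)
  also have "\<dots> = rk_cone T \<bar>x\<bar>"
    by (simp add: rk_add[symmetric] sup_sum_parts)
  also have "\<dots> \<le> (norm T * norm \<bar>x\<bar>) *\<^sub>R order_unit"
    by (rule rk_least) (auto intro: rk_bound)
  finally show "norm (?Q x) \<le> norm x * norm T"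
    by (subst norm_le_iff_abs_le_order_unit) (auto simp: norm_abs_eq mult.commute)
qed

lemma blinfun_pos_part_apply:
  assumes "0 \<le> x"
  shows "blinfun_pos_part T x = rk_cone T x"
  using rk_diff[of x 0] assms rk_scaleR[of 0 0]
  by (simp add: blinfun_pos_part_def bounded_linear_Blinfun_apply[OF blinfun_pos_part_bounded_linear])

end

instantiation blinfun :: (banach_lattice, order_complete_unit_banach_lattice) banach_lattice
begin

definition less_eq_blinfun :: "('a \<Rightarrow>\<^sub>L 'b) \<Rightarrow> ('a \<Rightarrow>\<^sub>L 'b) \<Rightarrow> bool" where
  "S \<le> T \<longleftrightarrow> (\<forall>x\<ge>0. S x \<le> T x)" for S T :: "'a \<Rightarrow>\<^sub>L 'b"

definition less_blinfun :: "('a \<Rightarrow>\<^sub>L 'b) \<Rightarrow> ('a \<Rightarrow>\<^sub>L 'b) \<Rightarrow> bool" where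
  "S < T \<longleftrightarrow> S \<le> T \<and> \<not> T \<le> S" for S T :: "'a \<Rightarrow>\<^sub>L 'b"

definition sup_blinfun :: "('a \<Rightarrow>\<^sub>L 'b) \<Rightarrow> ('a \<Rightarrow>\<^sub>L 'b) \<Rightarrow> 'a \<Rightarrow>\<^sub>L 'b" where
  "sup S T = T + blinfun_pos_part (S - T)" for S T :: "'a \<Rightarrow>\<^sub>L 'b"

definition inf_blinfun :: "('a \<Rightarrow>\<^sub>L 'b) \<Rightarrow> ('a \<Rightarrow>\<^sub>L 'b) \<Rightarrow> 'a \<Rightarrow>\<^sub>L 'b" where
  "inf S T = S - blinfun_pos_part (S - T)" for S T :: "'a \<Rightarrow>\<^sub>L 'b"

definition abs_blinfun :: "('a \<Rightarrow>\<^sub>L 'b) \<Rightarrow> 'a \<Rightarrow>\<^sub>L 'b" where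
  "\<bar>T\<bar> = sup T (- T)" for T :: "'a \<Rightarrow>\<^sub>L 'b"

instance
proof
  note defs = less_eq_blinfun_def blinfun.add_left blinfun.diff_left blinfun.scaleR_left
    blinfun.minus_left blinfun.zero_left
  have pos1: "U \<le> blinfun_pos_part U" for U :: "'a \<Rightarrow>\<^sub>L 'b"
    by (auto simp: defs blinfun_pos_part_apply intro: rk_upper)
  have pos2: "0 \<le> blinfun_pos_part U" for U :: "'a \<Rightarrow>\<^sub>L 'b"
    by (auto simp: defs blinfun_pos_part_apply intro: rk_nonneg)
  have pos3: "blinfun_pos_part U \<le> V" if "U \<le> V" "0 \<le> V" for U V :: "'a \<Rightarrow>\<^sub>L 'b"
  proof -
    have "U y \<le> V x" if "0 \<le> y" "y \<le> x" for x y
    proof -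
      have "U y \<le> V y" using that \<open>U \<le> V\<close> by (simp add: defs)
      moreover have "0 \<le> V (x - y)" using that \<open>0 \<le> V\<close> by (simp add: defs)
      ultimately show ?thesis by (simp add: blinfun.diff_right)
    qed
    then show ?thesis
      by (auto simp: less_eq_blinfun_def blinfun_pos_part_apply intro: rk_least)
  qed
  fix S T U :: "'a \<Rightarrow>\<^sub>L 'b" and a b :: real
  show "(S < T) = (S \<le> T \<and> \<not> T \<le> S)"
    by (rule less_blinfun_def)
  show "S \<le> S"
    by (simp add: defs)
  show "S \<le> U" if "S \<le> T" "T \<le> U"
    using that by (auto simp: defs intro: order.trans)
  show "S = T" if "S \<le> T" "T \<le> S"
  proof (rule blinfun_eqI)
    fix x
    have eq: "S y = T y" if "0 \<le> y" for y
      using that \<open>S \<le> T\<close> \<open>T \<le> S\<close> by (auto simp: defs intro: order.antisym)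
    have "S (sup x 0 - sup (- x) 0) = T (sup x 0 - sup (- x) 0)"
      by (simp only: blinfun.diff_right eq sup_ge2)
    then show "S x = T x"
      by (simp only: sup_diff_parts)
  qed
  show "U + S \<le> U + T" if "S \<le> T"
    using that by (simp add: defs)
  show "a *\<^sub>R S \<le> a *\<^sub>R T" if "S \<le> T" "0 \<le> a"
    using that by (simp add: defs scaleR_left_mono)
  show "a *\<^sub>R S \<le> b *\<^sub>R S" if "a \<le> b" "0 \<le> S"
    using that by (simp add: defs scaleR_right_mono)
  show "inf S T \<le> S"
    using pos2[of "S - T"] by (simp add: inf_blinfun_def defs)
  show "inf S T \<le> T"
    using pos1[of "S - T"] by (simp add: inf_blinfun_def defs algebra_simps)
  show "S \<le> inf T U" if "S \<le> T" "S \<le> U"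
    using pos3[of "T - U" "T - S"] that by (simp add: inf_blinfun_def defs algebra_simps)
  show "S \<le> sup S T"
    using pos1[of "S - T"] by (simp add: sup_blinfun_def defs algebra_simps)
  show "T \<le> sup S T"
    using pos2[of "S - T"] by (simp add: sup_blinfun_def defs)
  show "sup T U \<le> S" if "T \<le> S" "U \<le> S"
    using pos3[of "T - U" "S - U"] that by (simp add: sup_blinfun_def defs algebra_simps)
  show "\<bar>S\<bar> = sup S (- S)"
    by (rule abs_blinfun_def)
  show "norm S \<le> norm T" if "\<bar>S\<bar> \<le> \<bar>T\<bar>"
  proof (rule norm_blinfun_bound)
    fix x
    have S1: "S \<le> \<bar>S\<bar>"
      using pos1[of "S - - S"] by (simp add: abs_blinfun_def sup_blinfun_def defs algebra_simps)
    have S2: "- S \<le> \<bar>S\<bar>"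
      using pos2[of "S - - S"] by (simp add: abs_blinfun_def sup_blinfun_def defs algebra_simps)
    have p: "S (sup x 0) \<le> \<bar>S\<bar> (sup x 0)" "S (sup (- x) 0) \<le> \<bar>S\<bar> (sup (- x) 0)"
      "- S (sup x 0) \<le> \<bar>S\<bar> (sup x 0)" "- S (sup (- x) 0) \<le> \<bar>S\<bar> (sup (- x) 0)"
      using S1 S2 by (simp_all add: defs)
    have sx: "S x = S (sup x 0) + - S (sup (- x) 0)"
      using blinfun.diff_right[of S "sup x 0" "sup (- x) 0"]
      unfolding sup_diff_parts by simp
    have ax: "\<bar>S\<bar> \<bar>x\<bar> = \<bar>S\<bar> (sup x 0) + \<bar>S\<bar> (sup (- x) 0)"
      by (simp add: blinfun.add_right[symmetric] sup_sum_parts)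
    have "\<bar>S x\<bar> \<le> \<bar>S\<bar> \<bar>x\<bar>"
    proof (rule abs_leI)
      show "S x \<le> \<bar>S\<bar> \<bar>x\<bar>"
        unfolding sx ax by (intro add_mono p)
      have "- S (sup x 0) + S (sup (- x) 0) \<le> \<bar>S\<bar> \<bar>x\<bar>"
        unfolding ax by (intro add_mono p)
      then show "- S x \<le> \<bar>S\<bar> \<bar>x\<bar>"
        unfolding sx by (simp add: algebra_simps)
    qed
    also have "\<dots> \<le> \<bar>T\<bar> \<bar>x\<bar>"
      using that by (simp add: defs)
    also have "\<dots> = rk_cone (T - - T) \<bar>x\<bar> - T \<bar>x\<bar>"
      by (simp add: abs_blinfun_def sup_blinfun_def blinfun.add_left blinfun.diff_left blinfun.minus_left
          blinfun_pos_part_apply)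
    also have "\<dots> \<le> (norm T * norm x) *\<^sub>R order_unit"
    proof -
      have "rk_cone (T - - T) \<bar>x\<bar> \<le> (norm T * norm x) *\<^sub>R order_unit + T \<bar>x\<bar>"
      proof (rule rk_least)
        fix y assume y: "0 \<le> y" "y \<le> \<bar>x\<bar>"
        have "\<bar>y + y - \<bar>x\<bar>\<bar> \<le> \<bar>x\<bar>"
        proof (rule abs_leI)
          show "y + y - \<bar>x\<bar> \<le> \<bar>x\<bar>"
            using add_mono[OF y(2) y(2)] by (simp add: algebra_simps)
          show "- (y + y - \<bar>x\<bar>) \<le> \<bar>x\<bar>"
            using add_mono[OF y(1) y(1)] by (simp add: algebra_simps)
        qed
        then have "norm (y + y - \<bar>x\<bar>) \<le> norm x"
          by (rule norm_mono_abs)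
        then have "T (y + y - \<bar>x\<bar>) \<le> (norm T * norm x) *\<^sub>R order_unit"
          by (rule order.trans[OF abs_ge_self blinfun_abs_le_order_unit])
        then show "(T - - T) y \<le> (norm T * norm x) *\<^sub>R order_unit + T \<bar>x\<bar>"
          by (simp add: blinfun.diff_left blinfun.add_left blinfun.minus_left blinfun.diff_right
              blinfun.add_right algebra_simps)
      qed simp
      then show ?thesis
        by (simp add: algebra_simps)
    qed
    finally show "norm (S x) \<le> norm T * norm x"
      by (subst norm_le_iff_abs_le_order_unit) auto
  qed simp
qed

end


section \<open>Cotype and the disjoint Dunford--Pettis property\<close>

text \<open>For \<open>k \<ge> 1\<close>; dyadic rationals are sent to 0 (a null set).\<close>

definition rademacher :: "nat \<Rightarrow> real \<Rightarrow> real" where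
  "rademacher k t = sgn (sin (2 ^ k * pi * t))"

text \<open>The \<open>x\<^sub>k\<close> are a finite family; repetitions are allowed.  For \<open>p > 0\<close> and a nonzero space the
  inequality forces \<open>p \<ge> 2\<close>; the explicit bound rules out the meaningless values \<open>p \<le> 0\<close>.\<close>

definition has_cotype :: "'a::banach itself \<Rightarrow> real \<Rightarrow> bool" where
  "has_cotype _ p \<longleftrightarrow> 2 \<le> p \<and>
    (\<exists>C>0. \<forall>(n::nat) (x :: nat \<Rightarrow> 'a).
      (\<Sum>k=1..n. norm (x k) powr p) powr (1 / p)
        \<le> C * sqrt (LBINT t:{0..1}. (norm (\<Sum>k=1..n. rademacher k t *\<^sub>R x k))\<^sup>2))"

definition disjoint_seq :: "(nat \<Rightarrow> 'a::banach_lattice) \<Rightarrow> bool" where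
  "disjoint_seq x \<longleftrightarrow> (\<forall>m n. n \<noteq> m \<longrightarrow> inf \<bar>x n\<bar> \<bar>x m\<bar> = 0)"

definition weakly_summable :: "real \<Rightarrow> (nat \<Rightarrow> 'a::real_normed_vector) \<Rightarrow> bool" where
  "weakly_summable p x \<longleftrightarrow> (\<forall>f :: 'a \<Rightarrow>\<^sub>L real. summable (\<lambda>n. \<bar>f (x n)\<bar> powr p))"

definition weakly_null :: "(nat \<Rightarrow> 'a::real_normed_vector) \<Rightarrow> bool" where
  "weakly_null x \<longleftrightarrow> (\<forall>f :: 'a \<Rightarrow>\<^sub>L real. (\<lambda>n. f (x n)) \<longlonglongrightarrow> 0)"

definition dunford_pettis_set :: "'a::real_normed_vector set \<Rightarrow> bool" where
  "dunford_pettis_set A \<longleftrightarrow>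
    (\<forall>f :: nat \<Rightarrow> ('a \<Rightarrow>\<^sub>L real).
      weakly_null f \<longrightarrow> uniform_limit A (\<lambda>n. blinfun_apply (f n)) (\<lambda>_. 0) sequentially)"

definition disjoint_DPP :: "'a::banach_lattice itself \<Rightarrow> real \<Rightarrow> bool" where
  "disjoint_DPP _ p \<longleftrightarrow>
    (\<forall>x :: nat \<Rightarrow> 'a. disjoint_seq x \<and> weakly_summable p x \<longrightarrow> dunford_pettis_set (range x))"

end

theory Submission
  imports Defs
begin

text \<open>
  Suppose that a disjoint weakly \<open>p\<close>-summable sequence \<open>x\<close> in \<open>E\<close> and a weakly null sequence \<open>f\<close> in
  \<open>E\<^sup>*\<close> violate the property.  After passing to a subsequence of \<open>x\<close> and choosing functionals from
  the range of \<open>f\<close>, one has \<open>\<bar>f\<^sub>j(x\<^sub>j)\<bar> \<ge> e > 0\<close> for all \<open>j\<close>.  The idea is to exchange the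
  roles of the two sequences: \<open>x\<close> becomes a weakly null sequence in \<open>E\<^sup>*\<^sup>*\<close>, and the \<open>f\<^sub>j\<close> are
  replaced by a disjoint weakly \<open>p\<close>-summable sequence \<open>g\<close> in \<open>E\<^sup>*\<close> with \<open>g\<^sub>j(x\<^sub>j) = f\<^sub>j(x\<^sub>j)\<close>.
  The disjoint Dunford--Pettis property of \<open>E\<^sup>*\<close> then yields \<open>g\<^sub>j(x\<^sub>j) \<rightarrow> 0\<close>, a contradiction.

  The functional \<open>g\<^sub>j\<close> is the part of \<open>f\<^sub>j\<close> that lives on the band generated by \<open>x\<^sub>j\<close>.  For
  \<open>f \<ge> 0\<close> and \<open>y \<ge> 0\<close> its value at \<open>y\<close> is the limit of \<open>f (y \<and> n\<bar>x\<^sub>j\<bar>)\<close> as \<open>n \<rightarrow> \<infinity>\<close>;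
  a general \<open>f\<close> is split into its positive and negative parts
  (\<open>signed_band_component_exists\<close>).  Functionals living on disjoint bands are disjoint
  (\<open>disjoint_band_components\<close>).

  Cotype gives the weak \<open>p\<close>-summability.  For \<open>y \<ge> 0\<close> the truncations \<open>y\<^sub>k = y \<and> n\<bar>x\<^sub>k\<bar>\<close> are disjoint, so
  that \<open>\<Sum>y\<^sub>k \<le> y\<close>, and every signed sum \<open>\<Sum>\<plusminus>y\<^sub>k\<close> has modulus at most \<open>y\<close>.  Hence
  \<open>\<Sum>\<parallel>y\<^sub>k\<parallel>\<^sup>p \<le> (C\<parallel>y\<parallel>)\<^sup>p\<close> (\<open>cotype_lower_estimate\<close>).  Since the \<open>f\<^sub>k\<close> are bounded, this turns into
  \<open>\<Sum>\<bar>g\<^sub>k(y)\<bar>\<^sup>p \<le> (MC\<parallel>y\<parallel>)\<^sup>p\<close> (\<open>sum_band_components_powr_le\<close>), and the duality between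
  \<open>p\<close>-th and \<open>q\<close>-th powers extends such an estimate from points of \<open>E\<close> to elements of \<open>E\<^sup>*\<^sup>*\<close>
  (\<open>weakly_summable_if_pointwise_bound\<close>).
\<close>

section \<open>Disjoint positive elements of a vector lattice\<close>

lemma inf_add_le:
  fixes x y u :: "'a::lattice_ab_group_add"
  assumes "0 \<le> x" "0 \<le> y" "0 \<le> u"
  shows "inf (x + y) u \<le> inf x u + inf y u"
proof -
  have u: "inf (x + y) u \<le> w + u" if "0 \<le> w" for w
    by (rule le_infI2) (use that in simp)
  \<comment> \<open>Distributivity writes the right-hand side as the infimum of these four sums.\<close>
  have "inf (x + y) u \<le> inf (inf (x + y) (u + y)) (inf (x + u) (u + u))"
    using u[OF assms(1)] u[OF assms(2)] u[OF assms(3)] by (simp add: add.commute)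
  also have "\<dots> = inf x u + inf y u"
    by (simp only: add_inf_distrib_left add_inf_distrib_right)
  finally show ?thesis .
qed

lemma inf_add_eq_0:
  fixes x y u :: "'a::lattice_ab_group_add"
  assumes "0 \<le> x" "0 \<le> y" "0 \<le> u" "inf x u = 0" "inf y u = 0"
  shows "inf (x + y) u = 0"
  using inf_add_le[OF assms(1-3)] assms by (intro order.antisym) simp_all

lemma inf_sum_eq_0:
  fixes y :: "nat \<Rightarrow> 'a::lattice_ab_group_add"
  assumes "\<And>k. k < n \<Longrightarrow> 0 \<le> y k \<and> inf (y k) u = 0" "0 \<le> u"
  shows "inf (\<Sum>k<n. y k) u = 0"
  using assms(1)
proof (induction n)
  case 0
  with assms(2) show ?case by (simp add: inf.absorb1)
next
  case (Suc n)
  then show ?case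
    using assms(2) by (simp, intro inf_add_eq_0) (auto intro!: sum_nonneg)
qed

text \<open>
  Since \<open>a + b = sup a b + inf a b\<close>, adding a disjoint element amounts to taking a supremum, and
  suprema of elements below \<open>x\<close> stay below \<open>x\<close>.
\<close>

lemma sum_disjoint_le:
  fixes y :: "nat \<Rightarrow> 'a::lattice_ab_group_add"
  assumes "\<And>k. 0 \<le> y k" "\<And>k. y k \<le> x" "0 \<le> x" "\<And>j k. j \<noteq> k \<Longrightarrow> inf (y j) (y k) = 0"
  shows "(\<Sum>k<n. y k) \<le> x"
proof (induction n)
  case (Suc n)
  have "inf (\<Sum>k<n. y k) (y n) = 0"
    by (rule inf_sum_eq_0) (use assms in auto)
  then have "(\<Sum>k<Suc n. y k) = sup (\<Sum>k<n. y k) (y n)"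
    using add_eq_inf_sup[of "\<Sum>k<n. y k" "y n"] by simp
  with Suc assms(2) show ?case by simp
qed (use assms in simp)

lemma inf_scaleR_nat_eq_0:
  fixes u v :: "'a::banach_lattice"
  assumes "0 \<le> u" "0 \<le> v" "inf u v = 0"
  shows "inf (real m *\<^sub>R u) v = 0"
proof (induction m)
  case 0
  with assms(2) show ?case by (simp add: inf.absorb1)
next
  case (Suc m)
  have "real (Suc m) *\<^sub>R u = u + real m *\<^sub>R u"
    by (simp add: scaleR_left_distrib)
  with Suc assms show ?case
    by (simp only:) (intro inf_add_eq_0; auto intro: scaleR_nonneg_nonneg)
qed

lemma scaleR_inf:
  fixes x y :: "'a::banach_lattice"
  assumes "0 < c"
  shows "c *\<^sub>R inf x y = inf (c *\<^sub>R x) (c *\<^sub>R y)"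
proof (rule order.antisym)
  have le: "c *\<^sub>R inf x y \<le> inf (c *\<^sub>R x) (c *\<^sub>R y)" if "0 < c" for c :: real and x y :: 'a
    using that by (auto intro!: scaleR_left_mono)
  show "c *\<^sub>R inf x y \<le> inf (c *\<^sub>R x) (c *\<^sub>R y)"
    by (rule le[OF assms])
  have "c *\<^sub>R (inverse c *\<^sub>R inf (c *\<^sub>R x) (c *\<^sub>R y))
      \<le> c *\<^sub>R inf (inverse c *\<^sub>R c *\<^sub>R x) (inverse c *\<^sub>R c *\<^sub>R y)"
    by (intro scaleR_left_mono le) (use assms in auto)
  then show "inf (c *\<^sub>R x) (c *\<^sub>R y) \<le> c *\<^sub>R inf x y"
    using assms by simp
qed


section \<open>The component of a functional in a principal band\<close>

lemma functional_mono:
  fixes f :: "'a::banach_lattice \<Rightarrow>\<^sub>L real"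
  assumes "0 \<le> f" "x \<le> y"
  shows "f x \<le> f y"
proof -
  have "0 \<le> f (y - x)"
    using assms by (simp add: less_eq_blinfun_def)
  then show ?thesis by (simp add: blinfun.diff_right)
qed

text \<open>
  Both \<open>g\<close> and \<open>- g\<close> lie below \<open>h\<close> on the positive and on the negative part of \<open>x\<close>, whose sum is
  \<open>\<bar>x\<bar>\<close>.
\<close>

lemma abs_functional_le:
  fixes g h :: "'a::banach_lattice \<Rightarrow>\<^sub>L real"
  assumes "\<bar>g\<bar> \<le> h"
  shows "\<bar>g x\<bar> \<le> h \<bar>x\<bar>"
proof -
  have "g \<le> h" "- g \<le> h"
    using assms abs_ge_self abs_ge_minus_self order.trans by blast+
  then have "g (sup x 0) \<le> h (sup x 0)" "g (sup (- x) 0) \<le> h (sup (- x) 0)"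
      "- g (sup x 0) \<le> h (sup x 0)" "- g (sup (- x) 0) \<le> h (sup (- x) 0)"
    by (auto simp: less_eq_blinfun_def blinfun.minus_left)
  moreover have "g x = g (sup x 0) - g (sup (- x) 0)"
    by (simp only: blinfun.diff_right[symmetric] sup_diff_parts)
  moreover have "h \<bar>x\<bar> = h (sup x 0) + h (sup (- x) 0)"
    by (simp only: blinfun.add_right[symmetric] sup_sum_parts)
  ultimately show ?thesis by linarith
qed

text \<open>
  The extension sends \<open>a - b\<close> to \<open>h a - h b\<close>; additivity makes this independent of the choice of
  \<open>a, b \<ge> 0\<close>, so that any convenient decomposition can be used to check linearity.
\<close>

lemma bounded_linear_of_cone:
  fixes h :: "'a::banach_lattice \<Rightarrow> real"
  assumes add: "\<And>x y. 0 \<le> x \<Longrightarrow> 0 \<le> y \<Longrightarrow> h (x + y) = h x + h y"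
    and scale: "\<And>c x. 0 < c \<Longrightarrow> 0 \<le> x \<Longrightarrow> h (c *\<^sub>R x) = c * h x"
    and bound: "\<And>x. 0 \<le> x \<Longrightarrow> \<bar>h x\<bar> \<le> K * norm x" and "0 \<le> K"
  obtains g :: "'a \<Rightarrow>\<^sub>L real" where "\<And>x. 0 \<le> x \<Longrightarrow> g x = h x"
proof -
  define Q where "Q x = h (sup x 0) - h (sup (- x) 0)" for x
  have h0: "h 0 = 0"
    using add[of 0 0] by simp
  have Q: "Q (a - b) = h a - h b" if "0 \<le> a" "0 \<le> b" for a b
  proof -
    have "s + b = a + t" if "s - t = a - b" for s t
      using that by (simp add: diff_eq_eq)
    from this[OF sup_diff_parts] have "h (sup (a - b) 0) + h b = h a + h (sup (- (a - b)) 0)"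
      using that by (metis add sup_ge2)
    then show ?thesis
      by (simp add: Q_def)
  qed
  have "bounded_linear Q"
  proof (rule bounded_linear_intro)
    fix x y :: 'a and r :: real
    have "x + y = (sup x 0 + sup y 0) - (sup (- x) 0 + sup (- y) 0)"
      by (simp only: add_diff_add sup_diff_parts)
    then show "Q (x + y) = Q x + Q y"
      using Q[of "sup x 0 + sup y 0" "sup (- x) 0 + sup (- y) 0"]
      by (simp add: Q_def[of x] Q_def[of y] add add_nonneg_nonneg)
    consider "r = 0" | "0 < r" | "r < 0" by linarith
    then show "Q (r *\<^sub>R x) = r *\<^sub>R Q x"
    proof cases
      case 1
      then show ?thesis by (simp add: Q_def)
    next
      case 2
      have "r *\<^sub>R x = r *\<^sub>R sup x 0 - r *\<^sub>R sup (- x) 0"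
        by (simp only: scaleR_right_diff_distrib[symmetric] sup_diff_parts)
      with 2 Q[of "r *\<^sub>R sup x 0" "r *\<^sub>R sup (- x) 0"] show ?thesis
        by (simp add: Q_def[of x] scale scaleR_nonneg_nonneg right_diff_distrib)
    next
      case 3
      have "r *\<^sub>R x = (- r) *\<^sub>R sup (- x) 0 - (- r) *\<^sub>R sup x 0"
      proof -
        have "r *\<^sub>R x = r *\<^sub>R sup x 0 - r *\<^sub>R sup (- x) 0"
          by (simp only: scaleR_right_diff_distrib[symmetric] sup_diff_parts)
        then show ?thesis by simp
      qed
      then have "Q (r *\<^sub>R x) = h ((- r) *\<^sub>R sup (- x) 0) - h ((- r) *\<^sub>R sup x 0)"
        using 3 by (simp only:) (rule Q; simp add: scaleR_nonneg_nonneg del: scaleR_minus_left)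
      also have "\<dots> = (- r) * h (sup (- x) 0) - (- r) * h (sup x 0)"
        using 3 by (subst (1 2) scale) auto
      finally show ?thesis
        by (simp add: Q_def algebra_simps)
    qed
  next
    fix x :: 'a
    have "norm (sup x 0) \<le> norm x" "norm (sup (- x) 0) \<le> norm x"
    proof -
      show "norm (sup x 0) \<le> norm x"
        by (rule norm_mono_abs) (simp add: abs_ge_self)
      show "norm (sup (- x) 0) \<le> norm x"
        by (rule norm_mono_abs) (simp add: abs_ge_minus_self)
    qed
    then have "K * norm (sup x 0) \<le> K * norm x" "K * norm (sup (- x) 0) \<le> K * norm x"
      using \<open>0 \<le> K\<close> by (auto intro: mult_left_mono)
    then show "norm (Q x) \<le> norm x * (2 * K)"
      using bound[of "sup x 0"] bound[of "sup (- x) 0"] by (simp add: Q_def algebra_simps)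
  qed
  then have "blinfun_apply (Blinfun Q) x = h x" if "0 \<le> x" for x
    using Q[of x 0] that by (simp add: bounded_linear_Blinfun_apply h0)
  then show ?thesis
    using that by blast
qed

text \<open>
  For \<open>f \<ge> 0\<close> and \<open>u \<ge> 0\<close>, this is the restriction to \<open>E\<close> of the composition of \<open>f\<close>, viewed as
  a functional on \<open>E\<^sup>*\<^sup>*\<close>, with the projection onto the band generated by \<open>u\<close>.  It is a relation in
  which \<open>f\<close> may have any sign, so that it is compatible with sums and differences by the limit laws.
\<close>

definition band_component :: "('a::banach_lattice \<Rightarrow>\<^sub>L real) \<Rightarrow> ('a \<Rightarrow>\<^sub>L real) \<Rightarrow> 'a \<Rightarrow> bool" where
  "band_component h f u \<longleftrightarrow> (\<forall>x\<ge>0. (\<lambda>n. f (inf x (real n *\<^sub>R u))) \<longlonglongrightarrow> h x)"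

lemma incseq_truncation:
  fixes f :: "'a::banach_lattice \<Rightarrow>\<^sub>L real"
  assumes "0 \<le> f" "0 \<le> u"
  shows "incseq (\<lambda>n. f (inf x (real n *\<^sub>R u)))"
  unfolding incseq_def
  by (intro allI impI functional_mono[OF assms(1)] inf_mono order.refl scaleR_right_mono[OF _ assms(2)])
    simp

lemma band_component_ge:
  assumes "band_component h f u" "0 \<le> f" "0 \<le> u" "0 \<le> x"
  shows "f (inf x (real n *\<^sub>R u)) \<le> h x"
  by (rule incseq_le[OF incseq_truncation]) (use assms in \<open>auto simp: band_component_def\<close>)

text \<open>
  The truncations increase with \<open>n\<close> and are bounded by \<open>f x\<close>, so they converge to their supremum.
  The supremum is additive in \<open>x\<close> because \<open>inf (x + y) v \<le> inf x v + inf y v\<close> and, conversely,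
  \<open>inf x (m u) + inf y (n u) \<le> inf (x + y) ((m + n) u)\<close>.
\<close>

lemma band_component_exists:
  fixes f :: "'a::banach_lattice \<Rightarrow>\<^sub>L real"
  assumes "0 \<le> f" "0 \<le> u"
  obtains h where "band_component h f u" "0 \<le> h"
proof -
  let ?t = "\<lambda>x n. f (inf x (real n *\<^sub>R u))"
  define L where "L x = (SUP n. ?t x n)" for x
  have nn: "0 \<le> ?t x n" if "0 \<le> x" for x n
    using functional_mono[OF assms(1), of 0 "inf x (real n *\<^sub>R u)"] that assms
    by (simp add: blinfun.zero_right scaleR_nonneg_nonneg)
  have tx: "?t x n \<le> f x" for x n
    by (rule functional_mono[OF assms(1)]) simp
  have bdd: "bdd_above (range (?t x))" for x
    using tx by (rule bdd_aboveI2)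
  have lim: "?t x \<longlonglongrightarrow> L x" for x
    unfolding L_def by (rule LIMSEQ_incseq_SUP[OF bdd incseq_truncation[OF assms]])
  have upper: "?t x n \<le> L x" for x n
    unfolding L_def by (rule cSUP_upper[OF _ bdd]) simp
  have least: "L x \<le> z" if "\<And>n. ?t x n \<le> z" for x z
    unfolding L_def by (rule cSUP_least) (use that in auto)
  have L0: "0 \<le> L x" if "0 \<le> x" for x
    using nn[OF that] upper by (meson order.trans)
  obtain h :: "'a \<Rightarrow>\<^sub>L real" where h: "\<And>x. 0 \<le> x \<Longrightarrow> h x = L x"
  proof (rule bounded_linear_of_cone[of L "norm f"])
    fix x y :: 'a assume xy: "0 \<le> x" "0 \<le> y"
    show "L (x + y) = L x + L y"
    proof (rule order.antisym)
      show "L (x + y) \<le> L x + L y"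
      proof (rule least)
        fix n
        have "inf (x + y) (real n *\<^sub>R u) \<le> inf x (real n *\<^sub>R u) + inf y (real n *\<^sub>R u)"
          by (rule inf_add_le) (use xy assms in \<open>auto intro: scaleR_nonneg_nonneg\<close>)
        then have "?t (x + y) n \<le> ?t x n + ?t y n"
          unfolding blinfun.add_right[symmetric] by (rule functional_mono[OF assms(1)])
        then show "?t (x + y) n \<le> L x + L y"
          using upper[of x n] upper[of y n] by linarith
      qed
      have "?t x m + ?t y n \<le> L (x + y)" for m n
      proof -
        have "inf x (real m *\<^sub>R u) + inf y (real n *\<^sub>R u) \<le> inf (x + y) (real (m + n) *\<^sub>R u)"
          by (auto simp: scaleR_left_distrib intro: add_mono)
        then have "?t x m + ?t y n \<le> ?t (x + y) (m + n)"
          unfolding blinfun.add_right[symmetric] by (rule functional_mono[OF assms(1)])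
        then show ?thesis
          using upper[of "x + y" "m + n"] by linarith
      qed
      then have "?t x m \<le> L (x + y) - L y" for m
        using least[of y "L (x + y) - ?t x m"] by (simp add: algebra_simps)
      then show "L x + L y \<le> L (x + y)"
        using least[of x "L (x + y) - L y"] by (simp add: algebra_simps)
    qed
  next
    have le: "c * L x \<le> L (c *\<^sub>R x)" if c: "0 < c" and x: "0 \<le> x" for c x
    proof -
      \<comment> \<open>Scaling turns the multiple \<open>n u\<close> into \<open>(c n) u\<close>, which the next integer multiple dominates.\<close>
      have "?t x n \<le> L (c *\<^sub>R x) / c" for n
      proof -
        have "c *\<^sub>R inf x (real n *\<^sub>R u) = inf (c *\<^sub>R x) ((c * real n) *\<^sub>R u)"
          using c by (simp add: scaleR_inf)
        also have "\<dots> \<le> inf (c *\<^sub>R x) (real (nat \<lceil>c * real n\<rceil>) *\<^sub>R u)"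
          by (intro inf_mono order.refl scaleR_right_mono assms) linarith
        finally have "c * ?t x n \<le> ?t (c *\<^sub>R x) (nat \<lceil>c * real n\<rceil>)"
          using functional_mono[OF assms(1)] by (fastforce simp: blinfun.scaleR_right)
        then show ?thesis
          using upper[of "c *\<^sub>R x" "nat \<lceil>c * real n\<rceil>"] c by (simp add: field_simps)
      qed
      then have "L x \<le> L (c *\<^sub>R x) / c"
        by (rule least)
      with c show ?thesis by (simp add: field_simps)
    qed
    fix c :: real and x :: 'a assume cx: "0 < c" "0 \<le> x"
    then have "inverse c * L (c *\<^sub>R x) \<le> L x"
      using le[of "inverse c" "c *\<^sub>R x"] by (simp add: scaleR_nonneg_nonneg)
    with le[OF cx] cx show "L (c *\<^sub>R x) = c * L x"
      by (simp add: field_simps)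
  next
    fix x :: 'a assume "0 \<le> x"
    then have "\<bar>L x\<bar> \<le> f x"
      using L0[of x] least[OF tx, of x] by simp
    also have "\<dots> \<le> norm f * norm x"
      using norm_blinfun[of f x] by simp
    finally show "\<bar>L x\<bar> \<le> norm f * norm x" .
  qed auto
  have "band_component h f u"
    using lim h by (simp add: band_component_def)
  moreover have "0 \<le> h"
    using h L0 by (simp add: less_eq_blinfun_def)
  ultimately show ?thesis
    by (rule that)
qed

text \<open>
  Let \<open>w = inf h k\<close> and cut \<open>x \<ge> 0\<close> at \<open>y = inf x (n u)\<close>.  Because \<open>y\<close> is disjoint from \<open>v\<close>,
  \<open>w y \<le> k y = 0\<close>; on the rest, \<open>w (x - y) \<le> h x - h y\<close>, which tends to \<open>0\<close> as \<open>n\<close> grows,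
  because \<open>h\<close> is the limit of \<open>f\<close> on the truncations and \<open>f y \<le> h y\<close>.
\<close>

lemma disjoint_band_components:
  assumes "band_component h f u" "0 \<le> f" "0 \<le> h" "0 \<le> u"
    and "band_component k g v" "0 \<le> g" "0 \<le> k" "0 \<le> v"
    and "inf u v = 0"
  shows "inf h k = 0"
proof (rule order.antisym)
  show "0 \<le> inf h k"
    using assms by simp
  show "inf h k \<le> 0"
    unfolding less_eq_blinfun_def
  proof (intro allI impI)
    fix x :: 'a assume x: "0 \<le> x"
    let ?w = "inf h k"
    have w: "?w y \<le> h y" "?w y \<le> k y" if "0 \<le> y" for y
      using that inf.cobounded1[of h k] inf.cobounded2[of h k] unfolding less_eq_blinfun_def by auto
    have "f (inf x (real n *\<^sub>R u)) \<le> h x - ?w x" for n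
    proof -
      let ?y = "inf x (real n *\<^sub>R u)"
      have y: "0 \<le> ?y" "?y \<le> x"
        using x assms by (auto intro: scaleR_nonneg_nonneg)
      have "inf (real n *\<^sub>R u) (real m *\<^sub>R v) = 0" for m
        using inf_scaleR_nat_eq_0[of v "real n *\<^sub>R u" m] inf_scaleR_nat_eq_0[of u v n] assms
        by (simp add: inf.commute scaleR_nonneg_nonneg)
      then have "inf ?y (real m *\<^sub>R v) \<le> 0" for m
        by (metis inf.cobounded2 inf_mono order.refl)
      moreover have "0 \<le> inf ?y (real m *\<^sub>R v)" for m
        using y assms by (simp add: scaleR_nonneg_nonneg)
      ultimately have "inf ?y (real m *\<^sub>R v) = 0" for m
        by (rule order.antisym)
      then have "g (inf ?y (real m *\<^sub>R v)) = 0" for m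
        by (simp only: blinfun.zero_right)
      moreover have "(\<lambda>m. g (inf ?y (real m *\<^sub>R v))) \<longlonglongrightarrow> k ?y"
        using assms(5) y(1) unfolding band_component_def by blast
      ultimately have "k ?y = 0"
        by (simp only: LIMSEQ_const_iff)
      then have "?w ?y \<le> 0"
        using w[OF y(1)] by simp
      moreover have "?w (x - ?y) \<le> h (x - ?y)"
        by (rule w(1)) (use y(2) in \<open>simp only: diff_ge_0_iff_ge\<close>)
      moreover have "f ?y \<le> h ?y"
        using band_component_ge[OF assms(1,2,4) y(1), of n] by simp
      ultimately show ?thesis
        unfolding blinfun.diff_right by linarith
    qed
    then have "h x \<le> h x - ?w x"
      using assms(1) x by (intro LIMSEQ_le_const2[of "\<lambda>n. f (inf x (real n *\<^sub>R u))"]) (auto simp: band_component_def)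
    then show "?w x \<le> blinfun_apply 0 x"
      by (simp add: blinfun.zero_left)
  qed
qed

text \<open>
  The components of the positive and the negative part of \<open>f\<close> have difference \<open>g\<close> and sum \<open>h\<close>.
  Nothing is lost at \<open>x\<close> itself: the positive and negative part of \<open>x\<close> lie below \<open>\<bar>x\<bar>\<close>, so that
  their truncations are constant from \<open>n = 1\<close> on.
\<close>

lemma signed_band_component_exists:
  fixes f :: "'a::banach_lattice \<Rightarrow>\<^sub>L real"
  obtains g h where "band_component h \<bar>f\<bar> \<bar>x\<bar>" "0 \<le> h" "\<bar>g\<bar> \<le> h" "g x = f x"
proof -
  obtain g1 where g1: "band_component g1 (sup f 0) \<bar>x\<bar>" "0 \<le> g1"
    by (rule band_component_exists[of "sup f 0" "\<bar>x\<bar>"]) auto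
  obtain g2 where g2: "band_component g2 (sup (- f) 0) \<bar>x\<bar>" "0 \<le> g2"
    by (rule band_component_exists[of "sup (- f) 0" "\<bar>x\<bar>"]) auto
  have add: "band_component (g1 + g2) (sup f 0 + sup (- f) 0) \<bar>x\<bar>"
    using g1(1) g2(1) unfolding band_component_def blinfun.add_left
    by (intro allI impI tendsto_add) simp_all
  have diff: "band_component (g1 - g2) (sup f 0 - sup (- f) 0) \<bar>x\<bar>"
    using g1(1) g2(1) unfolding band_component_def blinfun.diff_left
    by (intro allI impI tendsto_diff) simp_all
  have eq: "(g1 - g2) y = f y" if y: "0 \<le> y" "y \<le> \<bar>x\<bar>" for y
  proof -
    have "(\<lambda>n. f (inf y (real n *\<^sub>R \<bar>x\<bar>))) \<longlonglongrightarrow> (g1 - g2) y"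
      using diff y unfolding sup_diff_parts band_component_def by blast
    moreover have "inf y (real n *\<^sub>R \<bar>x\<bar>) = y" if "1 \<le> n" for n
    proof (rule inf.absorb1)
      have "1 *\<^sub>R \<bar>x\<bar> \<le> real n *\<^sub>R \<bar>x\<bar>"
        by (rule scaleR_right_mono) (use that in auto)
      with y(2) show "y \<le> real n *\<^sub>R \<bar>x\<bar>" by simp
    qed
    then have "eventually (\<lambda>n. f (inf y (real n *\<^sub>R \<bar>x\<bar>)) = f y) sequentially"
      by (intro eventually_sequentiallyI[of 1]) simp
    then have "(\<lambda>n. f (inf y (real n *\<^sub>R \<bar>x\<bar>))) \<longlonglongrightarrow> f y"
      by (rule tendsto_eventually)
    ultimately show ?thesis
      by (rule LIMSEQ_unique)
  qed
  have "(g1 - g2) (sup x 0 - sup (- x) 0) = f (sup x 0 - sup (- x) 0)"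
    unfolding blinfun.diff_right by (simp add: eq abs_ge_self abs_ge_minus_self)
  then have "(g1 - g2) x = f x"
    unfolding sup_diff_parts .
  moreover have "\<bar>g1 - g2\<bar> \<le> g1 + g2"
    using g1 g2 by (intro abs_leI) (simp_all add: add_increasing add_increasing2 diff_le_eq add.assoc)
  ultimately show ?thesis
    using that[of "g1 + g2" "g1 - g2"] add g1 g2 unfolding sup_sum_parts by simp
qed


section \<open>Weakly \<open>p\<close>-summable sequences\<close>

text \<open>Young's inequality is applied to the two families after normalising them.\<close>

lemma Hoelder_inequality_sum:
  fixes a b :: "'i \<Rightarrow> real"
  assumes pq: "1 < p" "1 < q" "1 / p + 1 / q = 1"
    and nn: "\<And>i. i \<in> I \<Longrightarrow> 0 \<le> a i" "\<And>i. i \<in> I \<Longrightarrow> 0 \<le> b i"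
  shows "(\<Sum>i\<in>I. a i * b i) \<le> (\<Sum>i\<in>I. a i powr p) powr (1 / p) * (\<Sum>i\<in>I. b i powr q) powr (1 / q)"
proof (cases "(\<Sum>i\<in>I. a i powr p) = 0 \<or> (\<Sum>i\<in>I. b i powr q) = 0 \<or> infinite I")
  case True
  then have "(\<Sum>i\<in>I. a i * b i) = 0"
    by (cases "finite I") (auto simp: sum_nonneg_eq_0_iff)
  then show ?thesis by simp
next
  case False
  define A where "A = (\<Sum>i\<in>I. a i powr p) powr (1 / p)"
  define B where "B = (\<Sum>i\<in>I. b i powr q) powr (1 / q)"
  have pos: "0 < A" "0 < B"
    using False by (auto simp: A_def B_def)
  have pow: "A powr p = (\<Sum>i\<in>I. a i powr p)" "B powr q = (\<Sum>i\<in>I. b i powr q)"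
    using pq by (simp_all add: A_def B_def powr_powr sum_nonneg)
  have "(\<Sum>i\<in>I. a i * b i) / (A * B) = (\<Sum>i\<in>I. (a i / A) * (b i / B))"
    by (simp add: sum_divide_distrib)
  also have "\<dots> \<le> (\<Sum>i\<in>I. (a i / A) powr p / p + (b i / B) powr q / q)"
    by (intro sum_mono Youngs_inequality pq) (use nn pos in auto)
  also have "\<dots> = (\<Sum>i\<in>I. a i powr p) / A powr p / p + (\<Sum>i\<in>I. b i powr q) / B powr q / q"
    using nn pos by (simp add: sum.distrib sum_divide_distrib powr_divide)
  also have "\<dots> = 1"
    using False pow pq(3) by simp
  finally show ?thesis
    using pos by (simp add: field_simps flip: A_def B_def)
qed

text \<open>
  Testing \<open>\<phi>\<close> on one suitable combination \<open>G\<close> of the \<open>g\<^sub>k\<close> is enough to pass from the points of the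
  space to an element \<open>\<phi>\<close> of its bidual.  The coefficients of \<open>G\<close> are those for which
  Hoelder's inequality is sharp, so that \<open>\<phi> G\<close> is the sum \<open>S\<close> to be estimated.  Hoelder's
  inequality at each point \<open>x\<close> bounds the norm of \<open>G\<close> by \<open>K S powr (1 / q)\<close>, and the powers of
  \<open>S\<close> cancel.
\<close>

lemma weakly_summable_if_pointwise_bound:
  fixes g :: "nat \<Rightarrow> 'a::real_normed_vector \<Rightarrow>\<^sub>L real"
  assumes p: "1 < p" and K: "0 \<le> K"
    and bound: "\<And>n x. (\<Sum>k<n. \<bar>g k x\<bar> powr p) \<le> (K * norm x) powr p"
  shows "weakly_summable p g"
  unfolding weakly_summable_def
proof
  fix \<phi> :: "('a \<Rightarrow>\<^sub>L real) \<Rightarrow>\<^sub>L real"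
  define t where "t k = \<bar>\<phi> (g k)\<bar>" for k
  define q where "q = p / (p - 1)"
  have q: "1 < q" "1 / q + 1 / p = 1" "(p - 1) * q = p"
    using p by (auto simp: q_def field_simps)
  have "(\<Sum>k<n. t k powr p) \<le> (norm \<phi> * K) powr p" for n
  proof (cases "(\<Sum>k<n. t k powr p) = 0")
    case False
    define S where "S = (\<Sum>k<n. t k powr p)"
    have S: "0 < S"
      using False by (simp add: S_def sum_nonneg order.strict_iff_order)
    define G where "G = (\<Sum>k<n. (sgn (\<phi> (g k)) * t k powr (p - 1)) *\<^sub>R g k)"
    have "sgn (\<phi> (g k)) * t k powr (p - 1) * \<phi> (g k) = t k powr p" for k
    proof (cases "t k = 0")
      case False
      have "sgn (\<phi> (g k)) * \<phi> (g k) = t k"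
        unfolding t_def by (simp add: sgn_mult_self_eq abs_sgn mult.commute)
      then have "sgn (\<phi> (g k)) * t k powr (p - 1) * \<phi> (g k) = t k powr (p - 1) * t k"
        by (metis mult.assoc mult.commute)
      also have "\<dots> = t k powr p"
        using False powr_add[of "t k" "p - 1" 1] by (simp add: t_def)
      finally show ?thesis .
    qed (simp add: t_def)
    then have \<phi>G: "\<phi> G = S"
      unfolding G_def S_def by (simp add: blinfun.sum_right blinfun.scaleR_right)
    have "norm G \<le> S powr (1 / q) * K"
    proof (rule norm_blinfun_bound)
      fix x
      have "norm (G x) \<le> (\<Sum>k<n. norm ((sgn (\<phi> (g k)) * t k powr (p - 1)) *\<^sub>R g k x))"
        unfolding G_def blinfun.sum_left blinfun.scaleR_left by (rule norm_sum)
      also have "\<dots> \<le> (\<Sum>k<n. t k powr (p - 1) * \<bar>g k x\<bar>)"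
        by (intro sum_mono) (simp add: abs_mult sgn_if)
      also have "\<dots> \<le> (\<Sum>k<n. (t k powr (p - 1)) powr q) powr (1 / q)
          * (\<Sum>k<n. \<bar>g k x\<bar> powr p) powr (1 / p)"
        by (rule Hoelder_inequality_sum) (use p q in auto)
      also have "\<dots> \<le> S powr (1 / q) * ((K * norm x) powr p) powr (1 / p)"
        using p q(1) bound[of x n] by (intro mult_mono powr_mono2) (auto simp: powr_powr q(3) S_def sum_nonneg)
      also have "\<dots> = S powr (1 / q) * K * norm x"
        using p K by (simp add: powr_powr)
      finally show "norm (G x) \<le> S powr (1 / q) * K * norm x" .
    qed (use K in simp)
    then have "norm \<phi> * norm G \<le> norm \<phi> * (S powr (1 / q) * K)"
      by (rule mult_left_mono) simp
    with norm_blinfun[of \<phi> G] have "S \<le> norm \<phi> * K * S powr (1 / q)"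
      using \<phi>G S by (simp add: mult.commute mult.left_commute)
    moreover have "S = S powr (1 / p) * S powr (1 / q)"
      using S q(2) by (simp add: add.commute flip: powr_add)
    ultimately have "S powr (1 / p) * S powr (1 / q) \<le> norm \<phi> * K * S powr (1 / q)"
      by linarith
    then have "S powr (1 / p) \<le> norm \<phi> * K"
      using S by simp
    then have "(S powr (1 / p)) powr p \<le> (norm \<phi> * K) powr p"
      using p by (intro powr_mono2) auto
    then show ?thesis
      using S p by (simp add: powr_powr flip: S_def)
  qed simp
  then show "summable (\<lambda>k. \<bar>\<phi> (g k)\<bar> powr p)"
    by (intro summableI_nonneg_bounded) (auto simp: t_def)
qed

lemma weakly_summable_imp_weakly_null:
  assumes "weakly_summable p x" "0 < p"
  shows "weakly_null x"
  unfolding weakly_null_def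
proof
  fix f :: "'a \<Rightarrow>\<^sub>L real"
  have "(\<lambda>n. \<bar>f (x n)\<bar> powr p) \<longlonglongrightarrow> 0"
    using assms(1) unfolding weakly_summable_def by (blast intro: summable_LIMSEQ_zero)
  then have "(\<lambda>n. (\<bar>f (x n)\<bar> powr p) powr (1 / p)) \<longlonglongrightarrow> 0 powr (1 / p)"
    by (rule tendsto_powr'[OF _ tendsto_const]) (use assms(2) in auto)
  then show "(\<lambda>n. f (x n)) \<longlonglongrightarrow> 0"
    using assms(2) by (simp add: powr_powr tendsto_rabs_zero_iff)
qed


section \<open>Cotype and disjoint functionals\<close>

text \<open>
  For positive elements every choice of signs satisfies \<open>\<bar>\<Sum>\<plusminus>y\<^sub>k\<bar> \<le> \<Sum>y\<^sub>k \<le> x\<close>, so the Rademacher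
  average in the cotype inequality is at most the norm of \<open>x\<close>.
\<close>

lemma cotype_lower_estimate:
  assumes "has_cotype TYPE('a::banach_lattice) p"
  obtains C where "0 < C"
    "\<And>(n::nat) (y :: nat \<Rightarrow> 'a) x. (\<And>k. 0 \<le> y k) \<Longrightarrow> (\<Sum>k<n. y k) \<le> x \<Longrightarrow>
      (\<Sum>k<n. norm (y k) powr p) \<le> (C * norm x) powr p"
proof -
  from assms obtain C where p: "2 \<le> p" and C: "0 < C"
    and ct: "\<And>(n::nat) (x :: nat \<Rightarrow> 'a). (\<Sum>k=1..n. norm (x k) powr p) powr (1 / p)
        \<le> C * sqrt (LBINT t:{0..1}. (norm (\<Sum>k=1..n. rademacher k t *\<^sub>R x k))\<^sup>2)"
    unfolding has_cotype_def by blast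
  have "(\<Sum>k<n. norm (y k) powr p) \<le> (C * norm x) powr p"
    if y: "\<And>k. 0 \<le> y k" and x: "(\<Sum>k<n. y k) \<le> x" for n x and y :: "nat \<Rightarrow> 'a"
  proof -
    \<comment> \<open>Rademacher functions are numbered from \<open>1\<close>.\<close>
    define z where "z k = y (k - 1)" for k
    define S where "S = (\<Sum>k<n. norm (y k) powr p)"
    have Sz: "S = (\<Sum>k=1..n. norm (z k) powr p)"
      by (simp add: S_def z_def sum.atLeast1_atMost_eq)
    have xz: "(\<Sum>k=1..n. z k) \<le> x"
      using x by (simp add: z_def sum.atLeast1_atMost_eq)
    have z: "0 \<le> z k" for k
      using y by (simp add: z_def)
    have bound: "norm (\<Sum>k=1..n. rademacher k t *\<^sub>R z k) \<le> norm x" for t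
    proof (rule norm_mono_abs)
      have r: "\<bar>rademacher k t\<bar> \<le> 1" for k
        by (simp add: rademacher_def abs_sgn_eq)
      have "(\<Sum>k=1..n. rademacher k t *\<^sub>R z k) \<le> (\<Sum>k=1..n. 1 *\<^sub>R z k)"
        using r z by (intro sum_mono scaleR_right_mono) (auto simp: abs_le_iff)
      moreover have "(\<Sum>k=1..n. (- rademacher k t) *\<^sub>R z k) \<le> (\<Sum>k=1..n. 1 *\<^sub>R z k)"
        using r z by (intro sum_mono scaleR_right_mono) (auto simp: abs_le_iff)
      ultimately have "\<bar>\<Sum>k=1..n. rademacher k t *\<^sub>R z k\<bar> \<le> (\<Sum>k=1..n. z k)"
        by (intro abs_leI) (simp_all add: sum_negf)
      with xz show "\<bar>\<Sum>k=1..n. rademacher k t *\<^sub>R z k\<bar> \<le> \<bar>x\<bar>"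
        using abs_ge_self[of x] by (meson order.trans)
    qed
    have "(LBINT t:{0..1}. (norm (\<Sum>k=1..n. rademacher k t *\<^sub>R z k))\<^sup>2)
        \<le> (\<integral>t. indicator {0..1::real} t *\<^sub>R (norm x)\<^sup>2 \<partial>lborel)"
      \<comment> \<open>The integral of a function that is not integrable is \<open>0\<close> by default, below the bound as well.\<close>
      unfolding set_lebesgue_integral_def
      using bound by (intro integral_mono') (auto split: split_indicator intro: power_mono)
    also have "\<dots> = (norm x)\<^sup>2"
      by simp
    finally have "sqrt (LBINT t:{0..1}. (norm (\<Sum>k=1..n. rademacher k t *\<^sub>R z k))\<^sup>2) \<le> norm x"
      by (intro real_le_lsqrt) auto
    then have "C * sqrt (LBINT t:{0..1}. (norm (\<Sum>k=1..n. rademacher k t *\<^sub>R z k))\<^sup>2) \<le> C * norm x"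
      using C by simp
    with ct[where n = n and x = z] have "S powr (1 / p) \<le> C * norm x"
      unfolding Sz by linarith
    then have "(S powr (1 / p)) powr p \<le> (C * norm x) powr p"
      using p by (intro powr_mono2) auto
    moreover have "0 \<le> S"
      by (simp add: S_def sum_nonneg)
    ultimately show ?thesis
      using p by (simp add: powr_powr flip: S_def)
  qed
  with C show ?thesis
    using that by blast
qed

text \<open>
  The truncations of \<open>x\<close> at the disjoint elements \<open>m u\<^sub>k\<close> are disjoint and therefore have a sum
  below \<open>x\<close>.  The lower estimate applies to them with a bound that does not depend on \<open>m\<close>, and
  \<open>m \<rightarrow> \<infinity>\<close> gives the claim.
\<close>

lemma sum_band_components_powr_le:
  fixes f h :: "nat \<Rightarrow> 'a::banach_lattice \<Rightarrow>\<^sub>L real"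
  assumes p: "0 < p" and C: "0 \<le> C"
    and lower: "\<And>y x. (\<And>k. 0 \<le> y k) \<Longrightarrow> (\<Sum>k<n. y k) \<le> x \<Longrightarrow>
      (\<Sum>k<n. norm (y k) powr p) \<le> (C * norm (x::'a)) powr p"
    and comp: "\<And>k. band_component (h k) (f k) (u k)"
    and f: "\<And>k. 0 \<le> f k" "\<And>k. norm (f k) \<le> M"
    and u: "\<And>k. 0 \<le> u k" "\<And>j k. j \<noteq> k \<Longrightarrow> inf (u j) (u k) = 0"
    and x: "0 \<le> x"
  shows "(\<Sum>k<n. h k x powr p) \<le> (M * C * norm x) powr p"
proof -
  define y where "y m k = inf x (real m *\<^sub>R u k)" for m k
  have M: "0 \<le> M"
    using f(2)[of 0] norm_ge_zero order.trans by blast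
  have y0: "0 \<le> y m k" for m k
    using x u by (simp add: y_def scaleR_nonneg_nonneg)
  have fy0: "0 \<le> f k (y m k)" for m k
    using functional_mono[OF f(1) y0] by (simp add: blinfun.zero_right)
  have "(\<Sum>k<n. f k (y m k) powr p) \<le> (M * C * norm x) powr p" for m
  proof -
    have "inf (y m j) (y m k) = 0" if "j \<noteq> k" for j k
    proof (rule order.antisym)
      have "inf (real m *\<^sub>R u j) (u k) = 0"
        by (rule inf_scaleR_nat_eq_0) (use u that in auto)
      then have "inf (real m *\<^sub>R u k) (real m *\<^sub>R u j) = 0"
        by (intro inf_scaleR_nat_eq_0) (use u in \<open>auto simp: inf.commute scaleR_nonneg_nonneg\<close>)
      moreover have "inf (y m j) (y m k) \<le> inf (real m *\<^sub>R u k) (real m *\<^sub>R u j)"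
        unfolding y_def by (meson inf.cobounded1 inf.cobounded2 inf_greatest order.trans)
      ultimately show "inf (y m j) (y m k) \<le> 0" by simp
    qed (simp add: y0)
    then have "(\<Sum>k<n. y m k) \<le> x"
      by (intro sum_disjoint_le y0 x) (auto simp: y_def)
    then have le: "(\<Sum>k<n. norm (y m k) powr p) \<le> (C * norm x) powr p"
      by (intro lower y0)
    have "f k (y m k) \<le> M * norm (y m k)" for k
      using norm_blinfun[of "f k" "y m k"] mult_right_mono[OF f(2) norm_ge_zero, of k "y m k"]
      unfolding real_norm_def by linarith
    then have "(\<Sum>k<n. f k (y m k) powr p) \<le> (\<Sum>k<n. (M * norm (y m k)) powr p)"
      using p by (intro sum_mono powr_mono2 fy0) auto
    also have "\<dots> = M powr p * (\<Sum>k<n. norm (y m k) powr p)"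
      using M by (simp add: powr_mult sum_distrib_left)
    also have "\<dots> \<le> M powr p * (C * norm x) powr p"
      using le by (rule mult_left_mono) simp
    also have "\<dots> = (M * C * norm x) powr p"
      using M C by (simp add: powr_mult mult.assoc)
    finally show ?thesis .
  qed
  moreover have "(\<lambda>m. \<Sum>k<n. f k (y m k) powr p) \<longlonglongrightarrow> (\<Sum>k<n. h k x powr p)"
    using comp x fy0 p unfolding band_component_def y_def
    by (intro tendsto_sum tendsto_powr') auto
  ultimately show ?thesis
    by (intro LIMSEQ_le_const2) auto
qed


section \<open>Transfer of the disjoint Dunford--Pettis property\<close>

text \<open>
  The sets where all \<open>f n\<close> are bounded by \<open>m\<close> are closed and cover the space, so by Baire's theorem
  one of them contains a ball; differences of points of this ball fill a neighbourhood of \<open>0\<close>.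
\<close>

lemma uniform_boundedness:
  fixes f :: "nat \<Rightarrow> 'a::banach \<Rightarrow>\<^sub>L 'b::real_normed_vector"
  assumes "\<And>x. bounded (range (\<lambda>n. f n x))"
  obtains M where "\<And>n. norm (f n) \<le> M"
proof -
  define T where "T m = {x. \<forall>n. norm (f n x) \<le> real m}" for m :: nat
  have closed: "closed (T m)" for m
    unfolding T_def by (intro closed_Collect_all closed_Collect_le continuous_intros)
  have "x \<in> \<Union>(range T)" for x
  proof -
    obtain B where "\<And>n. norm (f n x) \<le> B"
      using assms[of x] by (auto simp: bounded_iff)
    moreover obtain m :: nat where "B \<le> real m"
      using real_arch_simple by blast
    ultimately have "x \<in> T m"
      by (auto simp: T_def intro: order.trans)
    then show ?thesis by blast
  qed
  then have "\<Union>(range T) = UNIV"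
    by blast
  have "\<exists>m. interior (T m) \<noteq> {}"
  proof (rule ccontr)
    assume "\<not> ?thesis"
    then have "euclidean interior_of \<Union>(range T) = {}"
      by (intro Baire_category_alt) (auto simp: closed completely_metrizable_space_euclidean)
    with \<open>\<Union>(range T) = UNIV\<close> show False by simp
  qed
  then obtain m x r where r: "0 < r" and ball: "ball x r \<subseteq> T m"
    by (metis all_not_in_conv mem_interior)
  have "norm (f n) \<le> 4 * real m / r" for n
  proof (rule norm_blinfun_bound)
    fix y
    show "norm (f n y) \<le> 4 * real m / r * norm y"
    proof (cases "y = 0")
      case False
      \<comment> \<open>The factor \<open>2\<close> keeps \<open>x + c y\<close> inside the open ball.\<close>
      define c where "c = r / (2 * norm y)"
      have c: "0 < c" "norm (c *\<^sub>R y) < r"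
        using False r by (auto simp: c_def)
      have "x \<in> T m" "x + c *\<^sub>R y \<in> T m"
        using ball c r by (auto simp: dist_norm)
      then have "norm (f n x) \<le> real m" "norm (f n (x + c *\<^sub>R y)) \<le> real m"
        by (auto simp: T_def)
      moreover have "c * norm (f n y) = norm (f n (x + c *\<^sub>R y) - f n x)"
        using c by (simp add: blinfun.add_right blinfun.scaleR_right)
      ultimately have "c * norm (f n y) \<le> 2 * real m"
        using norm_triangle_ineq4[of "f n (x + c *\<^sub>R y)" "f n x"] by linarith
      then show ?thesis
        using False r by (simp add: c_def field_simps)
    qed (simp add: blinfun.zero_right)
  qed (use r in simp)
  then show ?thesis
    by (rule that)
qed

text \<open>
  A functional on the bidual restricts to a functional on the space along the canonical embedding
  \<open>blinfun.prod_left\<close>.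
\<close>

lemma weakly_null_evaluation:
  fixes x :: "nat \<Rightarrow> 'a::real_normed_vector"
  assumes "weakly_null x"
  shows "weakly_null (\<lambda>n. blinfun.prod_left (x n) :: ('a \<Rightarrow>\<^sub>L real) \<Rightarrow>\<^sub>L real)"
  unfolding weakly_null_def
proof
  fix \<Phi> :: "(('a \<Rightarrow>\<^sub>L real) \<Rightarrow>\<^sub>L real) \<Rightarrow>\<^sub>L real"
  have "bounded_linear (\<lambda>y. \<Phi> (blinfun.prod_left y))"
    by (intro bounded_linear_intros blinfun.bounded_linear_prod_left)
  note eq = bounded_linear_Blinfun_apply[OF this]
  have "(\<lambda>n. Blinfun (\<lambda>y. \<Phi> (blinfun.prod_left y)) (x n)) \<longlonglongrightarrow> 0"
    using assms unfolding weakly_null_def by blast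
  then show "(\<lambda>n. \<Phi> (blinfun.prod_left (x n))) \<longlonglongrightarrow> 0"
    by (simp only: eq)
qed

lemma weakly_null_pointwise:
  fixes f :: "nat \<Rightarrow> 'a::real_normed_vector \<Rightarrow>\<^sub>L real"
  assumes "weakly_null f"
  shows "(\<lambda>n. f n x) \<longlonglongrightarrow> 0"
proof -
  have "(\<lambda>n. (blinfun.prod_left x :: ('a \<Rightarrow>\<^sub>L real) \<Rightarrow>\<^sub>L real) (f n)) \<longlonglongrightarrow> 0"
    using assms unfolding weakly_null_def by blast
  then show ?thesis by simp
qed

text \<open>
  Pointwise convergence is uniform on finite sets, so a failure of uniform convergence has to
  involve infinitely many points.
\<close>

lemma not_uniform_imp_infinite:
  fixes f :: "nat \<Rightarrow> 'a::real_normed_vector \<Rightarrow>\<^sub>L real"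
  assumes "\<And>y. (\<lambda>n. f n y) \<longlonglongrightarrow> 0"
    and "\<not> uniform_limit (range x) (\<lambda>n. blinfun_apply (f n)) (\<lambda>_. 0) sequentially"
  obtains e where "0 < e" "infinite {m. \<exists>n. e \<le> \<bar>f n (x m)\<bar>}"
proof -
  obtain e where e: "0 < e"
    and not: "\<not> (\<forall>\<^sub>F n in sequentially. \<forall>y\<in>range x. dist (f n y) 0 < e)"
    using assms(2) unfolding uniform_limit_iff by blast
  have "infinite {m. \<exists>n. e \<le> \<bar>f n (x m)\<bar>}" (is "infinite ?A")
  proof
    assume "finite ?A"
    moreover have "\<forall>m\<in>?A. \<forall>\<^sub>F n in sequentially. dist (f n (x m)) 0 < e"
      using tendstoD[OF assms(1) e] by blast
    ultimately have "\<forall>\<^sub>F n in sequentially. \<forall>m\<in>?A. dist (f n (x m)) 0 < e"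
      by (rule eventually_ball_finite)
    then have "\<forall>\<^sub>F n in sequentially. \<forall>y\<in>range x. dist (f n y) 0 < e"
      by (rule eventually_mono) (simp, metis not_le)
    with not show False ..
  qed
  with e show ?thesis
    by (rule that)
qed

theorem proposition2p4:
  fixes p :: real
  assumes "has_cotype TYPE('a::banach_lattice) p"
    and "disjoint_DPP TYPE('a \<Rightarrow>\<^sub>L real) p"
  shows "disjoint_DPP TYPE('a) p"
  unfolding disjoint_DPP_def dunford_pettis_set_def
proof (intro allI impI, elim conjE, rule ccontr)
  fix x :: "nat \<Rightarrow> 'a" and f :: "nat \<Rightarrow> 'a \<Rightarrow>\<^sub>L real"
  assume disj: "disjoint_seq x" and ws: "weakly_summable p x" and f: "weakly_null f"
    and not_unif: "\<not> uniform_limit (range x) (\<lambda>n. blinfun_apply (f n)) (\<lambda>_. 0) sequentially"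
  obtain e where e: "0 < e" and inf: "infinite {m. \<exists>n. e \<le> \<bar>f n (x m)\<bar>}" (is "infinite ?A")
    by (rule not_uniform_imp_infinite[OF weakly_null_pointwise[OF f] not_unif])
  have p: "2 \<le> p"
    using assms(1) by (simp add: has_cotype_def)
  obtain M where M: "\<And>n. norm (f n) \<le> M"
    by (rule uniform_boundedness[of f, OF convergent_imp_bounded[OF weakly_null_pointwise[OF f]]]) blast
  define r where "r = enumerate ?A"
  have r: "strict_mono r" "\<And>j. \<exists>n. e \<le> \<bar>f n (x (r j))\<bar>"
    using strict_mono_enumerate[OF inf] enumerate_in_set[OF inf] by (auto simp: r_def)
  then obtain n where n: "\<And>j. e \<le> \<bar>f (n j) (x (r j))\<bar>"
    by metis
  have "\<exists>g h. band_component h \<bar>f (n j)\<bar> \<bar>x (r j)\<bar> \<and> 0 \<le> h \<and> \<bar>g\<bar> \<le> h \<and> g (x (r j)) = f (n j) (x (r j))" for j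
    by (rule signed_band_component_exists[of "f (n j)" "x (r j)"]) blast
  then obtain g h where h: "\<And>j. band_component (h j) \<bar>f (n j)\<bar> \<bar>x (r j)\<bar>" "\<And>j. 0 \<le> h j"
    and g: "\<And>j. \<bar>g j\<bar> \<le> h j" "\<And>j. g j (x (r j)) = f (n j) (x (r j))"
    by metis
  have u: "inf \<bar>x (r i)\<bar> \<bar>x (r j)\<bar> = 0" if "i \<noteq> j" for i j
    using disj that strict_mono_eq[OF r(1)] by (simp add: disjoint_seq_def)
  have "disjoint_seq g"
    unfolding disjoint_seq_def
  proof (intro allI impI order.antisym)
    fix i j :: nat assume "j \<noteq> i"
    then have "inf (h j) (h i) = 0"
      by (intro disjoint_band_components[OF h(1) _ h(2) _ h(1) _ h(2)] u) auto
    moreover have "inf \<bar>g j\<bar> \<bar>g i\<bar> \<le> inf (h j) (h i)"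
      by (rule inf_mono[OF g(1) g(1)])
    ultimately show "inf \<bar>g j\<bar> \<bar>g i\<bar> \<le> 0" by simp
  qed simp
  moreover have "weakly_summable p g"
  proof -
    obtain C where C: "0 < C" and lower: "\<And>(n::nat) (y :: nat \<Rightarrow> 'a) x.
        (\<And>k. 0 \<le> y k) \<Longrightarrow> (\<Sum>k<n. y k) \<le> x \<Longrightarrow>
        (\<Sum>k<n. norm (y k) powr p) \<le> (C * norm x) powr p"
      by (rule cotype_lower_estimate[OF assms(1)]) blast
    show ?thesis
    proof (rule weakly_summable_if_pointwise_bound)
      show "1 < p" using p by simp
      show "0 \<le> M * C"
        using C M[of 0] norm_ge_zero[of "f 0"] by (intro mult_nonneg_nonneg) linarith+
      fix N and y :: 'a
      have "(\<Sum>k<N. \<bar>g k y\<bar> powr p) \<le> (\<Sum>k<N. h k \<bar>y\<bar> powr p)"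
        using p by (intro sum_mono powr_mono2 abs_functional_le g) auto
      also have "\<dots> \<le> (M * C * norm \<bar>y\<bar>) powr p"
        by (rule sum_band_components_powr_le[OF _ _ lower h(1)])
          (use p C M u in \<open>auto simp: norm_abs_eq\<close>)
      finally show "(\<Sum>k<N. \<bar>g k y\<bar> powr p) \<le> (M * C * norm y) powr p"
        by (simp add: norm_abs_eq)
    qed
  qed
  ultimately have "dunford_pettis_set (range g)"
    using assms(2) by (simp add: disjoint_DPP_def)
  moreover have "weakly_null (\<lambda>j. x (r j))"
    using weakly_summable_imp_weakly_null[OF ws] p LIMSEQ_subseq_LIMSEQ[OF _ r(1)]
    unfolding weakly_null_def o_def by auto
  ultimately have "uniform_limit (range g) (\<lambda>j. blinfun.prod_left (x (r j))) (\<lambda>_. 0) sequentially"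
    using weakly_null_evaluation[of "\<lambda>j. x (r j)"] unfolding dunford_pettis_set_def by blast
  then have "uniform_limit (range g) (\<lambda>j \<psi>. \<psi> (x (r j))) (\<lambda>_. 0) sequentially"
    by simp
  then have "\<forall>\<^sub>F j in sequentially. \<forall>\<psi>\<in>range g. dist (\<psi> (x (r j))) 0 < e"
    using e by (rule uniform_limitD)
  \<comment> \<open>Uniformity over \<open>range g\<close> allows the diagonal choice \<open>\<psi> = g j\<close>.\<close>
  then obtain j where "\<bar>g j (x (r j))\<bar> < e"
    by (auto simp: eventually_sequentially)
  with n[of j] g(2)[of j] show False by simp
qed

end
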